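(* Let $k\ge 3$ be an integer and let two nested circles in the plane $\mathbb{C}$ (the parent circles) be given that admit a Steiner chain of length $k$. Then for all integers $0\le n\le m\le k-1$ the complex number $$J_{m,n}=\sum_{j=1}^k b_j^m z_j^n,$$ where $b_1,\ldots,b_k$ are the curvatures and $z_1,\ldots,z_k\in\mathbb{C}$ the centers of the circles of a Steiner chain of length $k$ with the given parent circles, is the same for all Steiner chains of length $k$ with these parent circles; that is, $J_{m,n}$ remains constant in the 1-parameter family of Steiner chains of length $k$ having the given parent circles.
   Context: The plane is identified with $\mathbb{C}$, and $z^0=1$ for all $z\in\mathbb{C}$. Two circles in the plane are nested if one of them (the inner circle) lies in the open disk bounded by the other (the outer circle). Given two nested circles (called the parent circles), a Steiner chain of length $k$ is a cyclically ordered collection of $k$ pairwise distinct circles $c_1,\ldots,c_k$ inscribed in the annulus bounded by the parent circles, i.e. each $c_j$ is externally tangent to the inner parent circle and internally tangent to the outer parent circle, such that $c_j$ and $c_{j+1}$ are externally tangent for each $j$, with indices taken modulo $k$ (the chain closes up after $k$ steps). The chain is allowed to make several turns around the annulus, so non-consecutive circles may overlap. The curvature of a circle of radius $r$ in a Steiner chain is $b=1/r$. By the Steiner porism, if one Steiner chain of length $k$ exists for a pair of parent circles, then a Steiner chain of length $k$ exists starting from any circle inscribed in the annulus; these chains form a 1-parameter family. *)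

theory Defs
  imports "HOL-Analysis.Analysis"
begin

datatype circle = Circle (center: complex) (radius: real)

(* The datatype does not enforce positive radii, so nested and annulus_circle below
   require them explicitly; the tangency predicates presuppose them. *)
definition proper_circle :: "circle \<Rightarrow> bool" where
  "proper_circle c \<longleftrightarrow> 0 < radius c"

definition curvature :: "circle \<Rightarrow> real" where
  "curvature c = 1 / radius c"

(* The first argument is the inner circle: it lies in the open disk bounded by the second. *)
definition nested :: "circle \<Rightarrow> circle \<Rightarrow> bool" where
  "nested p q \<longleftrightarrow> proper_circle p \<and> proper_circle q \<and>
     sphere (center p) (radius p) \<subseteq> ball (center q) (radius q)"

definition externally_tangent :: "circle \<Rightarrow> circle \<Rightarrow> bool" where
  "externally_tangent c d \<longleftrightarrow> dist (center c) (center d) = radius c + radius d"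

(* c touches q from inside *)
definition internally_tangent :: "circle \<Rightarrow> circle \<Rightarrow> bool" where
  "internally_tangent c q \<longleftrightarrow> radius c < radius q \<and>
     dist (center c) (center q) = radius q - radius c"

definition annulus_circle :: "circle \<Rightarrow> circle \<Rightarrow> circle \<Rightarrow> bool" where
  "annulus_circle p q c \<longleftrightarrow>
     proper_circle c \<and> externally_tangent c p \<and> internally_tangent c q"

(* A chain of length k is c 0, ..., c (k - 1); values of c at indices \<ge> k are irrelevant. *)
definition steiner_chain :: "circle \<Rightarrow> circle \<Rightarrow> nat \<Rightarrow> (nat \<Rightarrow> circle) \<Rightarrow> bool" where
  "steiner_chain p q k c \<longleftrightarrow>
     inj_on c {..<k} \<and>
     (\<forall>j<k. annulus_circle p q (c j)) \<and>
     (\<forall>j<k. externally_tangent (c j) (c (Suc j mod k)))"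

end

theory Submission
  imports Defs "HOL-Computational_Algebra.Polynomial"
begin

text \<open>
  A circle with curvature \<open>b\<close> and center \<open>z\<close> is determined by the pair \<open>(b, b z)\<close>. Tangency to the
  two parent circles says that this point of \<open>\<real> \<times> \<complex>\<close> lies on a quadratic cone and in a plane; the
  section is an ellipse, because the parent circles are nested. Hence the inscribed circles are
  parametrized by a point \<open>u\<close> of the unit circle in such a way that \<open>b\<close> and \<open>b z\<close> are trigonometric
  polynomials of degree at most one, that is, linear combinations of \<open>1\<close>, \<open>u\<close> and \<open>cnj u\<close>, whose
  coefficients depend only on the parent circles (\<open>inscribed_circle_parametrization\<close>).

  The cone is the light cone of a Lorentz form, and tangency of two inscribed circles says that
  their points have a fixed Lorentz product. In the parameter \<open>u\<close> this fixes the real part of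
  \<open>u * cnj u'\<close>, hence the angle between \<open>u\<close> and \<open>u'\<close> up to sign. Since the circles of a Steiner
  chain are distinct, the sign cannot change along the chain, so that the parameters form an orbit
  \<open>v, g v, \<dots>, g ^ (k - 1) v\<close> with \<open>g\<close> a primitive \<open>k\<close>-th root of unity
  (\<open>constant_angle_steps_are_rotation\<close>).

  Finally \<open>b ^ m * z ^ n = b ^ (m - n) * (b z) ^ n\<close> is a trigonometric polynomial of degree at most
  \<open>m < k\<close> in \<open>u\<close>. Summing it over such an orbit kills every nonconstant frequency
  (\<open>sum_trigonometric_polynomial_orbit\<close>), and what is left is \<open>k\<close> times its constant coefficient,
  which does not depend on the chain.
\<close>

section \<open>Trigonometric polynomials on an orbit of a primitive root of unity\<close>

lemma sum_powers_orbit_eq_0: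
  fixes g v :: complex
  assumes "g ^ k = 1" and "g ^ l \<noteq> 1"
  shows "(\<Sum>j<k. (g ^ j * v) ^ l) = 0"
proof -
  have "(\<Sum>j<k. (g ^ j * v) ^ l) = v ^ l * (\<Sum>j<k. (g ^ l) ^ j)"
    by (simp add: power_mult_distrib sum_distrib_left mult.commute flip: power_mult)
  moreover have "(1 - g ^ l) * (\<Sum>j<k. (g ^ l) ^ j) = 1 - (g ^ l) ^ k"
    by (simp add: one_diff_power_eq)
  moreover have "(g ^ l) ^ k = 1"
    using assms(1) by (metis mult.commute power_mult power_one)
  ultimately show ?thesis
    using assms(2) by simp
qed

text \<open>
  Orthogonality of frequencies: as \<open>cnj u\<close> is the inverse of \<open>u\<close>, the summand is the pure frequency
  \<open>i - m\<close>, of absolute value less than \<open>k\<close>.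
\<close>

lemma sum_frequency_orbit:
  fixes g v :: complex and u :: "nat \<Rightarrow> complex"
  assumes u: "\<And>j. u j = g ^ j * v" and norm_u: "\<And>j. cmod (u j) = 1"
    and "g ^ k = 1" and prim: "\<And>l. 0 < l \<Longrightarrow> l < k \<Longrightarrow> g ^ l \<noteq> 1"
    and "i \<le> 2 * m" and "m < k"
  shows "(\<Sum>j<k. u j ^ i * cnj (u j) ^ m) = (if i = m then of_nat k else 0)"
proof -
  have zero: "(\<Sum>j<k. u j ^ l) = 0" if "0 < l" "l < k" for l
    unfolding u using assms(3) prim[OF that] by (rule sum_powers_orbit_eq_0)
  have unit: "u j ^ l * cnj (u j) ^ l = 1" for j l
    using norm_u[of j] by (simp add: complex_norm_square[symmetric] flip: power_mult_distrib)
  consider "i = m" | "i > m" | "i < m"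
    by linarith
  then show ?thesis
  proof cases
    case 1
    then show ?thesis
      by (simp add: unit)
  next
    case 2
    have "u j ^ i * cnj (u j) ^ m = u j ^ (i - m)" for j
    proof -
      have "u j ^ i = u j ^ (i - m) * u j ^ m"
        using 2 by (simp flip: power_add)
      then show ?thesis
        by (simp add: mult.assoc unit)
    qed
    then show ?thesis
      using zero[of "i - m"] 2 assms(5,6) by simp
  next
    case 3
    have "u j ^ i * cnj (u j) ^ m = cnj (u j ^ (m - i))" for j
    proof -
      have "cnj (u j) ^ m = cnj (u j) ^ i * cnj (u j) ^ (m - i)"
        using 3 by (simp flip: power_add)
      then show ?thesis
        by (simp add: mult.assoc[symmetric] unit)
    qed
    then have "(\<Sum>j<k. u j ^ i * cnj (u j) ^ m) = cnj (\<Sum>j<k. u j ^ (m - i))"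
      by (simp only: cnj_sum)
    then show ?thesis
      using zero[of "m - i"] 3 assms(6) by simp
  qed
qed

text \<open>
  Multiplying \<open>f0 + f1 u + f2 cnj u\<close> by \<open>u\<close> gives an ordinary quadratic polynomial in \<open>u\<close>. The
  constant coefficient of the product of \<open>l\<close> and \<open>n\<close> such factors is therefore the coefficient of
  degree \<open>l + n\<close> of the product of the quadratic polynomials.
\<close>

lemma sum_trigonometric_polynomial_orbit:
  fixes g v f0 f1 f2 h0 h1 h2 :: complex and u :: "nat \<Rightarrow> complex"
  assumes u: "\<And>j. u j = g ^ j * v" and norm_u: "\<And>j. cmod (u j) = 1"
    and "g ^ k = 1" and "\<And>l. 0 < l \<Longrightarrow> l < k \<Longrightarrow> g ^ l \<noteq> 1"
    and "l + n < k"
  shows "(\<Sum>j<k. (f0 + f1 * u j + f2 * cnj (u j)) ^ l * (h0 + h1 * u j + h2 * cnj (u j)) ^ n) =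
         of_nat k * coeff ([:f2, f0, f1:] ^ l * [:h2, h0, h1:] ^ n) (l + n)"
proof -
  define P where "P = [:f2, f0, f1:] ^ l * [:h2, h0, h1:] ^ n"
  have "degree P \<le> degree ([:f2, f0, f1:] ^ l) + degree ([:h2, h0, h1:] ^ n)"
    unfolding P_def by (rule degree_mult_le)
  also have "\<dots> \<le> degree [:f2, f0, f1:] * l + degree [:h2, h0, h1:] * n"
    by (intro add_mono degree_power_le)
  also have "\<dots> \<le> 2 * l + 2 * n"
    by (intro add_mono mult_right_mono) auto
  finally have deg: "degree P \<le> 2 * (l + n)"
    by simp
  have summand: "(f0 + f1 * u j + f2 * cnj (u j)) ^ l * (h0 + h1 * u j + h2 * cnj (u j)) ^ n =
      (\<Sum>i\<le>2 * (l + n). coeff P i * (u j ^ i * cnj (u j) ^ (l + n)))" for j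
  proof -
    have unit: "u j * cnj (u j) = 1"
      using norm_u[of j] by (simp add: complex_norm_square[symmetric])
    have factor: "r0 + r1 * u j + r2 * cnj (u j) = poly [:r2, r0, r1:] (u j) * cnj (u j)" for r0 r1 r2
    proof -
      have "poly [:r2, r0, r1:] (u j) * cnj (u j) =
          r2 * cnj (u j) + r0 * (u j * cnj (u j)) + r1 * u j * (u j * cnj (u j))"
        by (simp add: algebra_simps)
      then show ?thesis
        by (simp add: unit)
    qed
    have "(f0 + f1 * u j + f2 * cnj (u j)) ^ l * (h0 + h1 * u j + h2 * cnj (u j)) ^ n =
        poly P (u j) * cnj (u j) ^ (l + n)"
      unfolding factor P_def by (simp add: power_mult_distrib power_add mult_ac)
    also have "poly P (u j) = (\<Sum>i\<le>2 * (l + n). coeff P i * u j ^ i)"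
      unfolding poly_altdef using deg
      by (intro sum.mono_neutral_left) (auto simp: coeff_eq_0)
    finally show ?thesis
      by (simp add: sum_distrib_right mult.assoc)
  qed
  have "(\<Sum>j<k. (f0 + f1 * u j + f2 * cnj (u j)) ^ l * (h0 + h1 * u j + h2 * cnj (u j)) ^ n) =
      (\<Sum>i\<le>2 * (l + n). coeff P i * (\<Sum>j<k. u j ^ i * cnj (u j) ^ (l + n)))"
    unfolding summand by (subst sum.swap) (simp add: sum_distrib_left)
  also have "\<dots> = (\<Sum>i\<le>2 * (l + n). coeff P i * (if i = l + n then of_nat k else 0))"
    using sum_frequency_orbit[OF assms(1-4)] assms(5) by (intro sum.cong) auto
  also have "\<dots> = of_nat k * coeff P (l + n)"
    by (simp add: if_distrib mult.commute cong: if_cong)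
  finally show ?thesis
    unfolding P_def .
qed

section \<open>Closed walks on the unit circle with steps of constant angle\<close>

lemma unit_complex_eq_or_cnj:
  assumes "cmod x = 1" "cmod y = 1" "Re x = Re y"
  shows "x = y \<or> x = cnj y"
proof -
  have "(Im x)\<^sup>2 = (Im y)\<^sup>2"
    using assms cmod_power2[of x] cmod_power2[of y] by simp
  then show ?thesis
    using assms(3) by (auto simp: power2_eq_iff complex_eq_iff)
qed

text \<open>
  Consecutive quotients are equal or conjugate, as they have the same real part. Conjugate quotients
  would mean that the walk steps back to where it came from, and this is excluded by
  \<open>u (j + 2) \<noteq> u j\<close>.
\<close>

lemma constant_angle_steps_are_rotation:
  fixes u :: "nat \<Rightarrow> complex"
  assumes norm_u: "\<And>j. cmod (u j) = 1"
    and step: "\<And>j. Re (u (Suc j) * cnj (u j)) = \<kappa>"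
    and no_return: "\<And>j. u (Suc (Suc j)) \<noteq> u j"
  shows "\<exists>g. \<forall>j. u j = g ^ j * u 0"
proof -
  define q where "q j = u (Suc j) * cnj (u j)" for j
  have unit: "cnj (u j) * u j = 1" for j
    using norm_u[of j] by (simp add: complex_norm_square[symmetric] mult.commute)
  have norm_q: "cmod (q j) = 1" for j
    by (simp add: q_def norm_mult norm_u)
  have u_Suc: "u (Suc j) = q j * u j" for j
    by (simp add: q_def mult.assoc unit)
  have q_Suc: "q (Suc j) = q j" for j
  proof -
    have "q (Suc j) \<noteq> cnj (q j)"
    proof
      assume "q (Suc j) = cnj (q j)"
      then have "u (Suc (Suc j)) = (cnj (q j) * q j) * u j"
        by (simp add: u_Suc mult.assoc)
      also have "cnj (q j) * q j = 1"
        using norm_q[of j] by (simp add: complex_norm_square[symmetric] mult.commute)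
      finally show False
        using no_return[of j] by simp
    qed
    then show ?thesis
      using unit_complex_eq_or_cnj[OF norm_q norm_q, of "Suc j" j] step by (auto simp: q_def)
  qed
  have q_eq: "q j = q 0" for j
    by (induction j) (simp_all add: q_Suc)
  have "u j = q 0 ^ j * u 0" for j
  proof (induction j)
    case (Suc j)
    then show ?case
      using u_Suc[of j] q_eq[of j] by (simp add: mult.assoc)
  qed simp
  then show ?thesis
    by blast
qed

section \<open>Plane sections of the light cone\<close>

text \<open>
  Let \<open>D\<^sup>2 = A\<^sup>2 - B\<^sup>2\<close>. With respect to the Lorentz form \<open>t t' - x x' - y y'\<close>, the point
  \<open>(C / D\<^sup>2) (A, B, 0)\<close> is the center of the ellipse cut out of the light cone by \<open>A t - B x = C\<close>, and \<open>(B, A, 0) / D\<close> and \<open>(0, 0, 1)\<close>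
  are orthogonal directions of the plane, of square \<open>-1\<close>. The number \<open>section_parameter A B C D t x y\<close> is
  \<open>cos \<theta> + i sin \<theta>\<close> for the polar angle \<open>\<theta>\<close> of \<open>(t, x, y)\<close> in these coordinates, in which the ellipse
  is a circle of radius \<open>C / D\<close>.
\<close>

definition section_parameter ::
    "real \<Rightarrow> real \<Rightarrow> real \<Rightarrow> real \<Rightarrow> real \<Rightarrow> real \<Rightarrow> real \<Rightarrow> complex" where
  "section_parameter A B C D t x y = Complex ((A * x - B * t) / C) (D * y / C)"

lemma norm_section_parameter:
  assumes "A * t - B * x = C" "x\<^sup>2 + y\<^sup>2 = t\<^sup>2" "D\<^sup>2 = A\<^sup>2 - B\<^sup>2" "C \<noteq> 0"
  shows "cmod (section_parameter A B C D t x y) = 1"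
proof -
  have "(A * x - B * t)\<^sup>2 + (D * y)\<^sup>2 = (A * x - B * t)\<^sup>2 + (A\<^sup>2 - B\<^sup>2) * (t\<^sup>2 - x\<^sup>2)"
    using assms(2,3) by (simp add: power_mult_distrib flip: assms(2))
  also have "\<dots> = (A * t - B * x)\<^sup>2"
    by (simp add: power2_eq_square algebra_simps)
  also have "\<dots> = C\<^sup>2"
    by (simp add: assms(1))
  finally have "((A * x - B * t)\<^sup>2 + (D * y)\<^sup>2) / C\<^sup>2 = 1"
    using assms(4) by simp
  then show ?thesis
    by (simp add: section_parameter_def cmod_def power_divide add_divide_distrib)
qed

lemma section_point_of_parameter:
  fixes A B C D t x y :: real
  assumes "A * t - B * x = C" "D\<^sup>2 = A\<^sup>2 - B\<^sup>2" "C \<noteq> 0" "D \<noteq> 0"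
  defines "u \<equiv> section_parameter A B C D t x y"
  shows "t = C / D\<^sup>2 * (A + B * Re u)" "x = C / D\<^sup>2 * (B + A * Re u)" "y = C / D * Im u"
proof -
  have re: "C * Re u = A * x - B * t"
    using assms(3) by (simp add: u_def section_parameter_def)
  have "D\<^sup>2 * t = A * (A * t - B * x) + B * (A * x - B * t)"
    unfolding assms(2) by (simp add: power2_eq_square algebra_simps)
  then have "D\<^sup>2 * t = C * (A + B * Re u)"
    unfolding assms(1) re[symmetric] by (simp add: algebra_simps)
  then show "t = C / D\<^sup>2 * (A + B * Re u)"
    using assms(4) by (simp add: field_simps)
  have "D\<^sup>2 * x = B * (A * t - B * x) + A * (A * x - B * t)"
    unfolding assms(2) by (simp add: power2_eq_square algebra_simps)
  then have "D\<^sup>2 * x = C * (B + A * Re u)"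
    unfolding assms(1) re[symmetric] by (simp add: algebra_simps)
  then show "x = C / D\<^sup>2 * (B + A * Re u)"
    using assms(4) by (simp add: field_simps)
  show "y = C / D * Im u"
    using assms(3,4) by (simp add: u_def section_parameter_def)
qed

text \<open>
  The center of the ellipse has Lorentz square \<open>(C / D)\<^sup>2\<close> and is orthogonal to the directions of
  the plane, so the Lorentz product of two points of the section is \<open>(C / D)\<^sup>2 (1 - cos (\<theta> - \<theta>'))\<close>.
\<close>

lemma section_parameter_angle:
  assumes "A * t - B * x = C" "A * t' - B * x' = C" "D\<^sup>2 = A\<^sup>2 - B\<^sup>2" "C \<noteq> 0"
  shows "Re (section_parameter A B C D t x y * cnj (section_parameter A B C D t' x' y')) =
         1 - D\<^sup>2 * (t * t' - x * x' - y * y') / C\<^sup>2"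
proof -
  have "(A * x - B * t) * (A * x' - B * t') + D * y * (D * y') =
      (A * t - B * x) * (A * t' - B * x') - (A\<^sup>2 - B\<^sup>2) * (t * t' - x * x') + D\<^sup>2 * (y * y')"
    by (simp add: power2_eq_square algebra_simps)
  also have "\<dots> = C * C - D\<^sup>2 * (t * t' - x * x') + D\<^sup>2 * (y * y')"
    unfolding assms(1-3) ..
  also have "\<dots> = C\<^sup>2 - D\<^sup>2 * (t * t' - x * x' - y * y')"
    by (simp add: power2_eq_square algebra_simps)
  finally have "((A * x - B * t) * (A * x' - B * t') + D * y * (D * y')) / C\<^sup>2 =
      1 - D\<^sup>2 * (t * t' - x * x' - y * y') / C\<^sup>2"
    using assms(4) by (simp add: diff_divide_distrib)
  then show ?thesis
    by (simp add: section_parameter_def add_divide_distrib power2_eq_square)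
qed

section \<open>Circles inscribed in the annulus\<close>

lemma nested_imp_dist_less:
  assumes "nested p q"
  obtains a e where "0 \<le> a" "cmod e = 1" "center p - center q = of_real a * e"
    "a + radius p < radius q"
proof -
  define w where "w = center p - center q"
  define e where "e = (if w = 0 then 1 else sgn w)"
  have e: "cmod e = 1"
    by (simp add: e_def norm_sgn)
  have w: "w = of_real (cmod w) * e"
    by (simp add: e_def sgn_eq)
  have "0 < radius p" and sub: "sphere (center p) (radius p) \<subseteq> ball (center q) (radius q)"
    using assms by (auto simp: nested_def proper_circle_def)
  then have "center p + of_real (radius p) * e \<in> sphere (center p) (radius p)"
    using e by (simp add: dist_norm norm_mult)
  then have "center p + of_real (radius p) * e \<in> ball (center q) (radius q)"
    using sub by blast
  moreover have "center p + of_real (radius p) * e - center q = of_real (cmod w + radius p) * e"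
  proof -
    have "center p + of_real (radius p) * e - center q = w + of_real (radius p) * e"
      by (simp add: w_def)
    also have "\<dots> = of_real (cmod w) * e + of_real (radius p) * e"
      using w by simp
    finally show ?thesis
      by (simp add: algebra_simps)
  qed
  ultimately have "cmod (of_real (cmod w + radius p) * e) < radius q"
    by (simp only: mem_ball dist_norm norm_minus_commute[of "center q"])
  then have "cmod w + radius p < radius q"
    using e \<open>0 < radius p\<close> by (simp only: norm_mult norm_of_real) simp
  then show ?thesis
    using that[OF norm_ge_zero e w[unfolded w_def]] by (simp add: w_def)
qed

text \<open>
  Put the origin at the center of the outer circle, of radius \<open>R\<close>, and the first axis through the
  center \<open>a\<close> of the inner circle, of radius \<open>r\<close>. For a circle with curvature \<open>b\<close> and center \<open>z\<close> the
  tangency conditions, multiplied by \<open>b\<close>, read \<open>\<bar>b z\<bar> = R b - 1\<close> and \<open>\<bar>b z - a b\<bar> = r b + 1\<close>. The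
  first one is the cone; the difference of their squares is divisible by \<open>b\<close> and gives the plane.
\<close>

lemma inscribed_circle_on_section:
  fixes a r R \<rho> x y :: real
  assumes "\<rho> > 0" "R > 0"
    and outer: "cmod (Complex x y) = R - \<rho>"
    and inner: "cmod (Complex x y - of_real a) = \<rho> + r"
  shows "(x / \<rho>)\<^sup>2 + (y / \<rho>)\<^sup>2 = (R / \<rho> - 1)\<^sup>2"
    and "(R\<^sup>2 - r\<^sup>2 + a\<^sup>2) * (R / \<rho> - 1) - 2 * a * R * (x / \<rho>) = (R + r)\<^sup>2 - a\<^sup>2"
proof -
  have o2: "x\<^sup>2 + y\<^sup>2 = (R - \<rho>)\<^sup>2"
    using cmod_power2[of "Complex x y"] by (simp add: outer)
  have i2: "(x - a)\<^sup>2 + y\<^sup>2 = (\<rho> + r)\<^sup>2"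
    using cmod_power2[of "Complex x y - of_real a"] by (simp add: inner)
  have "(x / \<rho>)\<^sup>2 + (y / \<rho>)\<^sup>2 = (x\<^sup>2 + y\<^sup>2) / \<rho>\<^sup>2"
    by (simp add: power_divide add_divide_distrib)
  also have "\<dots> = ((R - \<rho>) / \<rho>)\<^sup>2"
    by (simp add: o2 power_divide)
  also have "(R - \<rho>) / \<rho> = R / \<rho> - 1"
    using assms(1) by (simp add: field_simps)
  finally show "(x / \<rho>)\<^sup>2 + (y / \<rho>)\<^sup>2 = (R / \<rho> - 1)\<^sup>2" .
  have "2 * a * x = R\<^sup>2 - r\<^sup>2 + a\<^sup>2 - 2 * (R + r) * \<rho>"
    using o2 i2 by (simp add: power2_eq_square algebra_simps)
  then have "2 * a * R * x = R * (R\<^sup>2 - r\<^sup>2 + a\<^sup>2 - 2 * (R + r) * \<rho>)"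
    by (simp add: mult_ac)
  then have "(R\<^sup>2 - r\<^sup>2 + a\<^sup>2) * (R - \<rho>) - 2 * a * R * x = ((R + r)\<^sup>2 - a\<^sup>2) * \<rho>"
    by (simp add: power2_eq_square algebra_simps)
  then have "((R\<^sup>2 - r\<^sup>2 + a\<^sup>2) * (R - \<rho>) - 2 * a * R * x) / \<rho> = (R + r)\<^sup>2 - a\<^sup>2"
    using assms(1) by simp
  then show "(R\<^sup>2 - r\<^sup>2 + a\<^sup>2) * (R / \<rho> - 1) - 2 * a * R * (x / \<rho>) = (R + r)\<^sup>2 - a\<^sup>2"
    using assms(1) by (simp add: field_simps)
qed

lemma tangent_circles_lorentz_product:
  fixes R \<rho> \<rho>' x y x' y' :: real
  assumes "\<rho> > 0" "\<rho>' > 0"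
    and outer: "cmod (Complex x y) = R - \<rho>" "cmod (Complex x' y') = R - \<rho>'"
    and tangent: "cmod (Complex x y - Complex x' y') = \<rho> + \<rho>'"
  shows "(R / \<rho> - 1) * (R / \<rho>' - 1) - (x / \<rho>) * (x' / \<rho>') - (y / \<rho>) * (y' / \<rho>') = 2"
proof -
  have "x\<^sup>2 + y\<^sup>2 = (R - \<rho>)\<^sup>2" "x'\<^sup>2 + y'\<^sup>2 = (R - \<rho>')\<^sup>2"
    using cmod_power2[of "Complex x y"] cmod_power2[of "Complex x' y'"] by (simp_all add: outer)
  moreover have "(x - x')\<^sup>2 + (y - y')\<^sup>2 = (\<rho> + \<rho>')\<^sup>2"
    using cmod_power2[of "Complex x y - Complex x' y'"] by (simp add: tangent)
  ultimately have "(R - \<rho>) * (R - \<rho>') - x * x' - y * y' = 2 * (\<rho> * \<rho>')"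
    by (simp add: power2_eq_square algebra_simps)
  then have "((R - \<rho>) * (R - \<rho>') - x * x' - y * y') / (\<rho> * \<rho>') = 2"
    using assms(1,2) by simp
  then show ?thesis
    using assms(1,2) by (simp add: field_simps)
qed

text \<open>
  The heart of the matter: all the properties come from the section of the light cone, once the
  configuration has been moved by the rigid motion that puts the outer center at the origin and the
  inner center on the nonnegative real axis. Undoing this motion replaces \<open>b z\<close> by a linear
  combination of \<open>b z\<close> and \<open>b\<close>, which is why the degree stays one.
\<close>

lemma inscribed_circle_parametrization:
  assumes "nested p q"
  obtains U :: "circle \<Rightarrow> complex" and f0 f1 f2 h0 h1 h2 :: complex and \<kappa> :: real
  where "\<And>c. annulus_circle p q c \<Longrightarrow> cmod (U c) = 1"
    and "\<And>c. annulus_circle p q c \<Longrightarrow>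
           of_real (curvature c) = f0 + f1 * U c + f2 * cnj (U c)"
    and "\<And>c. annulus_circle p q c \<Longrightarrow>
           of_real (curvature c) * center c = h0 + h1 * U c + h2 * cnj (U c)"
    and "\<And>c d. annulus_circle p q c \<Longrightarrow> annulus_circle p q d \<Longrightarrow> externally_tangent c d \<Longrightarrow>
           Re (U d * cnj (U c)) = \<kappa>"
proof -
  obtain a e where a: "0 \<le> a" and e: "cmod e = 1"
    and pq: "center p - center q = of_real a * e" and less: "a + radius p < radius q"
    using nested_imp_dist_less[OF assms] .
  define r R where "r = radius p" and "R = radius q"
  have "0 < r"
    using assms by (simp add: nested_def proper_circle_def r_def)
  have "a + r < R"
    using less by (simp add: r_def R_def)
  with a \<open>0 < r\<close> have "0 < R"
    by linarith
  define A B C where "A = R\<^sup>2 - r\<^sup>2 + a\<^sup>2" and "B = 2 * a * R" and "C = (R + r)\<^sup>2 - a\<^sup>2"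
  \<comment> \<open>Nestedness makes the normal of the plane timelike, so that the section is an ellipse.\<close>
  have "A\<^sup>2 - B\<^sup>2 = ((R - a)\<^sup>2 - r\<^sup>2) * ((R + a)\<^sup>2 - r\<^sup>2)"
    by (simp add: A_def B_def power2_eq_square algebra_simps)
  moreover have "r\<^sup>2 < (R - a)\<^sup>2" "r\<^sup>2 < (R + a)\<^sup>2" "a\<^sup>2 < (R + r)\<^sup>2"
    using \<open>0 < r\<close> a \<open>a + r < R\<close> by (auto intro!: power_strict_mono)
  ultimately have AB: "0 < A\<^sup>2 - B\<^sup>2" and "C \<noteq> 0"
    by (simp_all add: C_def)
  define D where "D = sqrt (A\<^sup>2 - B\<^sup>2)"
  have D: "D\<^sup>2 = A\<^sup>2 - B\<^sup>2" "D \<noteq> 0"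
    using AB by (simp_all add: D_def)
  define Z where "Z c = (center c - center q) * cnj e" for c
  define T X Y where "T c = R / radius c - 1" and "X c = Re (Z c) / radius c"
    and "Y c = Im (Z c) / radius c" for c
  define U where "U c = section_parameter A B C D (T c) (X c) (Y c)" for c
  have ee: "e * cnj e = 1"
    using e by (simp add: complex_norm_square[symmetric])
  have center: "center c = center q + e * Z c" for c
  proof -
    have "e * Z c = (e * cnj e) * (center c - center q)"
      by (simp add: Z_def mult_ac)
    then show ?thesis
      by (simp add: ee)
  qed
  have Z_diff: "cmod (Z c - Z d) = dist (center c) (center d)" for c d
  proof -
    have "Z c - Z d = (center c - center d) * cnj e"
      by (simp add: Z_def algebra_simps)
    then show ?thesis
      by (simp add: norm_mult e dist_norm)
  qed
  have Z_parents: "Z q = 0" "Z p = of_real a"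
    using ee by (simp_all add: Z_def pq mult.assoc)
  have radius_pos: "0 < radius c" if "annulus_circle p q c" for c
    using that by (simp add: annulus_circle_def proper_circle_def)
  have outer: "cmod (Complex (Re (Z c)) (Im (Z c))) = R - radius c" if "annulus_circle p q c" for c
    using that Z_diff[of c q]
    by (simp add: annulus_circle_def internally_tangent_def Z_parents R_def)
  have inner: "cmod (Complex (Re (Z c)) (Im (Z c)) - of_real a) = radius c + r"
    if "annulus_circle p q c" for c
    using that Z_diff[of c p]
    by (simp add: annulus_circle_def externally_tangent_def Z_parents r_def)
  have cone: "(X c)\<^sup>2 + (Y c)\<^sup>2 = (T c)\<^sup>2" and plane: "A * T c - B * X c = C"
    if "annulus_circle p q c" for c
    using inscribed_circle_on_section[OF radius_pos[OF that] \<open>0 < R\<close> outer[OF that] inner[OF that]]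
    by (simp_all add: A_def B_def C_def T_def X_def Y_def)
  have T: "T c = C / D\<^sup>2 * (A + B * Re (U c))" and X: "X c = C / D\<^sup>2 * (B + A * Re (U c))"
    and Y: "Y c = C / D * Im (U c)" if "annulus_circle p q c" for c
    using section_point_of_parameter[OF plane[OF that] D(1) \<open>C \<noteq> 0\<close> D(2)] by (simp_all add: U_def)
  define s where "s = C / D\<^sup>2"
  define f0 f1 where "f0 = (s * A + 1) / R" and "f1 = s * B / (2 * R)"
  define g0 g1 g2 where "g0 = s * B" and "g1 = (s * A + C / D) / 2" and "g2 = (s * A - C / D) / 2"
  have curv: "of_real (curvature c) = of_real f0 + of_real f1 * U c + of_real f1 * cnj (U c)"
    if "annulus_circle p q c" for c
  proof -
    have "curvature c = (T c + 1) / R"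
      using \<open>0 < R\<close> radius_pos[OF that] by (simp add: curvature_def T_def)
    also have "\<dots> = f0 + 2 * f1 * Re (U c)"
      using T[OF that] \<open>0 < R\<close> by (simp add: f0_def f1_def s_def[symmetric] field_simps)
    finally show ?thesis
      by (simp add: complex_eq_iff)
  qed
  have moment: "of_real (curvature c) * Z c =
      of_real g0 + of_real g1 * U c + of_real g2 * cnj (U c)" if "annulus_circle p q c" for c
  proof -
    have "of_real (curvature c) * Z c = Complex (X c) (Y c)"
      by (simp add: complex_eq_iff X_def Y_def curvature_def)
    moreover have "X c = g0 + g1 * Re (U c) + g2 * Re (U c)"
      using X[OF that] by (simp add: g0_def g1_def g2_def s_def[symmetric] field_simps)
    moreover have "Y c = g1 * Im (U c) - g2 * Im (U c)"
      using Y[OF that] by (simp add: g1_def g2_def field_simps)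
    ultimately show ?thesis
      by (simp add: complex_eq_iff)
  qed
  show ?thesis
  proof (rule that)
    show "cmod (U c) = 1" if "annulus_circle p q c" for c
      unfolding U_def using plane[OF that] cone[OF that] D(1) \<open>C \<noteq> 0\<close>
      by (rule norm_section_parameter)
    show "of_real (curvature c) = of_real f0 + of_real f1 * U c + of_real f1 * cnj (U c)"
      if "annulus_circle p q c" for c
      using curv[OF that] .
    show "of_real (curvature c) * center c =
        (of_real f0 * center q + e * of_real g0) + (of_real f1 * center q + e * of_real g1) * U c +
        (of_real f1 * center q + e * of_real g2) * cnj (U c)" if "annulus_circle p q c" for c
    proof -
      have "of_real (curvature c) * center c =
          of_real (curvature c) * center q + e * (of_real (curvature c) * Z c)"
        by (subst center) (simp add: algebra_simps)
      also have "\<dots> = (of_real f0 + of_real f1 * U c + of_real f1 * cnj (U c)) * center q +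
          e * (of_real g0 + of_real g1 * U c + of_real g2 * cnj (U c))"
        unfolding moment[OF that] unfolding curv[OF that] ..
      finally show ?thesis
        by (simp add: algebra_simps)
    qed
    show "Re (U d * cnj (U c)) = 1 - D\<^sup>2 * 2 / C\<^sup>2"
      if c: "annulus_circle p q c" and d: "annulus_circle p q d" and cd: "externally_tangent c d"
      for c d
    proof -
      have "cmod (Complex (Re (Z d)) (Im (Z d)) - Complex (Re (Z c)) (Im (Z c))) =
          radius d + radius c"
        using cd Z_diff[of d c] by (simp add: externally_tangent_def dist_commute)
      from tangent_circles_lorentz_product[OF radius_pos[OF d] radius_pos[OF c] outer[OF d]
          outer[OF c] this]
      have "T d * T c - X d * X c - Y d * Y c = 2"
        by (simp add: T_def X_def Y_def)
      then show ?thesis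
        unfolding U_def
        using section_parameter_angle[OF plane[OF d] plane[OF c] D(1) \<open>C \<noteq> 0\<close>] by simp
    qed
  qed
qed

section \<open>Invariance of the moments\<close>

theorem theorem3:
  fixes k m n :: nat and p q :: circle and c c' :: "nat \<Rightarrow> circle"
  assumes "k \<ge> 3"
    and "nested p q"
    and "n \<le> m" and "m \<le> k - 1"
    and "steiner_chain p q k c"
    and "steiner_chain p q k c'"
  shows "(\<Sum>j<k. complex_of_real (curvature (c j)) ^ m * center (c j) ^ n) =
         (\<Sum>j<k. complex_of_real (curvature (c' j)) ^ m * center (c' j) ^ n)"
proof -
  obtain U :: "circle \<Rightarrow> complex" and f0 f1 f2 h0 h1 h2 \<kappa>
    where U: "\<And>c. annulus_circle p q c \<Longrightarrow> cmod (U c) = 1"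
      and b: "\<And>c. annulus_circle p q c \<Longrightarrow>
           of_real (curvature c) = f0 + f1 * U c + f2 * cnj (U c)"
      and bz: "\<And>c. annulus_circle p q c \<Longrightarrow>
           of_real (curvature c) * center c = h0 + h1 * U c + h2 * cnj (U c)"
      and angle: "\<And>c d. annulus_circle p q c \<Longrightarrow> annulus_circle p q d \<Longrightarrow>
           externally_tangent c d \<Longrightarrow> Re (U d * cnj (U c)) = \<kappa>"
  proof (rule inscribed_circle_parametrization[OF assms(2)], goal_cases)
    case (1 U f0 f1 f2 h0 h1 h2 \<kappa>)
    show thesis
      using 1(2-5) by (rule 1(1))
  qed
  have U_inj: "x = y" if "annulus_circle p q x" "annulus_circle p q y" "U x = U y" for x y
  proof -
    have "complex_of_real (curvature x) = of_real (curvature y)"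
      "of_real (curvature x) * center x = of_real (curvature y) * center y"
      using b[OF that(1)] b[OF that(2)] bz[OF that(1)] bz[OF that(2)] that(3) by simp_all
    moreover have "0 < radius x" "0 < radius y"
      using that(1,2) by (simp_all add: annulus_circle_def proper_circle_def)
    ultimately show ?thesis
      by (cases x; cases y) (simp add: curvature_def)
  qed
  have chain_sum: "(\<Sum>j<k. complex_of_real (curvature (d j)) ^ m * center (d j) ^ n) =
      of_nat k * coeff ([:f2, f0, f1:] ^ (m - n) * [:h2, h0, h1:] ^ n) (m - n + n)"
    if d: "steiner_chain p q k d" for d
  proof -
    \<comment> \<open>Continuing the chain periodically removes the special role of its last step.\<close>
    define u where "u j = U (d (j mod k))" for j
    have "k > 0"
      using assms(1) by simp
    have ann: "annulus_circle p q (d (j mod k))" for j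
      using d \<open>k > 0\<close> by (simp add: steiner_chain_def)
    have u_eq: "i mod k = j mod k" if "u i = u j" for i j
    proof -
      have "d (i mod k) = d (j mod k)"
        using U_inj[OF ann ann] that by (simp add: u_def)
      then show ?thesis
        using d \<open>k > 0\<close> by (auto simp: steiner_chain_def dest: inj_onD)
    qed
    have norm_u: "cmod (u j) = 1" for j
      unfolding u_def using ann by (rule U)
    have step: "Re (u (Suc j) * cnj (u j)) = \<kappa>" for j
    proof -
      have "externally_tangent (d (j mod k)) (d (Suc (j mod k) mod k))"
        using d \<open>k > 0\<close> by (simp add: steiner_chain_def)
      then show ?thesis
        using angle[OF ann ann, of j "Suc j"] by (simp add: u_def mod_Suc_eq)
    qed
    have no_return: "u (Suc (Suc j)) \<noteq> u j" for j
    proof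
      assume "u (Suc (Suc j)) = u j"
      then have "(j + 2) mod k = j mod k"
        using u_eq[of "Suc (Suc j)" j] by simp
      then have "k dvd 2"
        using mod_eq_dvd_iff_nat[of j "j + 2" k] by simp
      then show False
        using assms(1) by (auto dest: dvd_imp_le)
    qed
    obtain g where g: "\<And>j. u j = g ^ j * u 0"
      using constant_angle_steps_are_rotation[of u \<kappa>, OF norm_u step no_return] by blast
    have "u 0 \<noteq> 0"
      using norm_u[of 0] by auto
    have "u k = u 0"
      by (simp add: u_def)
    then have gk: "g ^ k = 1"
      using g[of k] \<open>u 0 \<noteq> 0\<close> by simp
    have prim: "g ^ l \<noteq> 1" if "0 < l" "l < k" for l
    proof
      assume "g ^ l = 1"
      then have "u l = u 0"
        using g[of l] by simp
      then show False
        using u_eq[of l 0] that by simp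
    qed
    have "complex_of_real (curvature (d j)) ^ m * center (d j) ^ n =
        (f0 + f1 * u j + f2 * cnj (u j)) ^ (m - n) * (h0 + h1 * u j + h2 * cnj (u j)) ^ n"
      if "j < k" for j
    proof -
      have j: "annulus_circle p q (d j)" "u j = U (d j)"
        using ann[of j] that by (simp_all add: u_def)
      have "complex_of_real (curvature (d j)) ^ m * center (d j) ^ n =
          of_real (curvature (d j)) ^ (m - n) * (of_real (curvature (d j)) * center (d j)) ^ n"
        using assms(3) by (simp add: power_mult_distrib mult.assoc[symmetric] flip: power_add)
      then show ?thesis
        unfolding bz[OF j(1)] unfolding b[OF j(1)] j(2) .
    qed
    moreover have "m - n + n < k"
      using assms(1,3,4) by simp
    ultimately show ?thesis
      using sum_trigonometric_polynomial_orbit[of u g "u 0" k "m - n" n, OF g norm_u gk prim] by simp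
  qed
  show ?thesis
    unfolding chain_sum[OF assms(5)] chain_sum[OF assms(6)] ..
qed

end
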